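(* Let $T:\mathbb{R}^n\rightrightarrows\mathbb{R}^n$ be a maximal monotone operator with $T^{-1}(0)\neq\emptyset$. Let $\{z^k\}$, $\{\tilde z^k\}$, $\{v^k\}$, $\{\lambda_k\}$ and $\{\alpha_k\}$ be infinite sequences generated by Algorithm 1 (defined in the context) applied to $T$, so that $v^k\neq 0$ for all $k\ge 0$. If $\inf_k\lambda_k>0$ and $$\sum_{k=0}^\infty \alpha_k\|z^k-z^{k-1}\|^2<+\infty,$$ then $\{z^k\}$ converges to a point $z^\infty$ with $0\in T(z^\infty)$. Moreover, $\{\tilde z^k\}$ converges to the same point $z^\infty$, and $\{v^k\}$ converges to $0$.
   Context: $\langle\cdot,\cdot\rangle$ and $\|\cdot\|$ are the Euclidean inner product and norm on $\mathbb{R}^n$. Algorithm 1 (relative-error inertial-relaxed hybrid proximal projection method for $0\in T(z)$). Choose $z^0=z^{-1}\in\mathbb{R}^n$, constants $0\le\alpha,\sigma<1$ and $0<\underline\rho<\overline\rho<2$. For $k=0,1,\dots$: (1) choose $\alpha_k\in[0,\alpha]$ and set $w^k=z^k+\alpha_k(z^k-z^{k-1})$; (2) find $(\tilde z^k,v^k)\in\mathbb{R}^n\times\mathbb{R}^n$ and $\lambda_k>0$ such that $v^k\in T(\tilde z^k)$ and $\|\lambda_kv^k+\tilde z^k-w^k\|^2\le\sigma^2\left(\|\tilde z^k-w^k\|^2+\|\lambda_kv^k\|^2\right)$; (3) if $v^k=0$, stop; otherwise choose $\rho_k\in[\underline\rho,\overline\rho]$ and set $z^{k+1}=w^k-\rho_k\dfrac{\langle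 w^k-\tilde z^k,v^k\rangle}{\|v^k\|^2}v^k$. *)

theory Defs
  imports "HOL-Analysis.Analysis"
begin

text \<open>A point-to-set operator on $n$-dimensional Euclidean space is a function into sets; its graph
  consists of the pairs \<open>(x, u)\<close> with \<open>u \<in> T x\<close>.\<close>

definition monotone_operator :: "(real^'n \<Rightarrow> (real^'n) set) \<Rightarrow> bool" where
  "monotone_operator T \<longleftrightarrow>
     (\<forall>x y u v. u \<in> T x \<longrightarrow> v \<in> T y \<longrightarrow> (x - y) \<bullet> (u - v) \<ge> 0)"

text \<open>Maximality is with respect to inclusion of graphs.\<close>

definition maximal_monotone_operator :: "(real^'n \<Rightarrow> (real^'n) set) \<Rightarrow> bool" where
  "maximal_monotone_operator T \<longleftrightarrow>
     monotone_operator T \<and>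
     (\<forall>S. monotone_operator S \<longrightarrow> (\<forall>x. T x \<subseteq> S x) \<longrightarrow> S = T)"

definition inverse_operator :: "(real^'n \<Rightarrow> (real^'n) set) \<Rightarrow> real^'n \<Rightarrow> (real^'n) set" where
  "inverse_operator T u = {x. u \<in> T x}"

text \<open>The iterate $z^{k-1}$. The algorithm is initialised with $z^{-1} = z^0$, so the
  iterate preceding \<open>z 0\<close> is \<open>z 0\<close> itself and a sequence indexed by \<open>nat\<close> suffices.\<close>

definition prev_iterate :: "(nat \<Rightarrow> real^'n) \<Rightarrow> nat \<Rightarrow> real^'n" where
  "prev_iterate z k = (case k of 0 \<Rightarrow> z 0 | Suc j \<Rightarrow> z j)"

text \<open>The sequences form an infinite run of the relative-error inertial-relaxed hybrid proximal
  projection method. The \<open>k\<close>-th iteration makes the choices \<open>\<alpha>s k\<close>, \<open>zt k\<close>, \<open>v k\<close>, \<open>lam k\<close>, \<open>\<rho>s k\<close>;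
  the conjunct \<open>v k \<noteq> 0\<close> says that the stopping test never succeeds.\<close>

definition infinite_ihpp_run ::
  "(real^'n \<Rightarrow> (real^'n) set) \<Rightarrow> real \<Rightarrow> real \<Rightarrow> real \<Rightarrow> real \<Rightarrow>
   (nat \<Rightarrow> real^'n) \<Rightarrow> (nat \<Rightarrow> real^'n) \<Rightarrow> (nat \<Rightarrow> real^'n) \<Rightarrow> (nat \<Rightarrow> real^'n) \<Rightarrow>
   (nat \<Rightarrow> real) \<Rightarrow> (nat \<Rightarrow> real) \<Rightarrow> (nat \<Rightarrow> real) \<Rightarrow> bool" where
  "infinite_ihpp_run T \<alpha> \<sigma> \<rho>lo \<rho>hi z w zt v lam \<alpha>s \<rho>s \<longleftrightarrow>
     (\<forall>k. \<alpha>s k \<in> {0..\<alpha>} \<and>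
          w k = z k + \<alpha>s k *\<^sub>R (z k - prev_iterate z k) \<and>
          lam k > 0 \<and>
          v k \<in> T (zt k) \<and>
          (norm (lam k *\<^sub>R v k + zt k - w k))\<^sup>2
            \<le> \<sigma>\<^sup>2 * ((norm (zt k - w k))\<^sup>2 + (norm (lam k *\<^sub>R v k))\<^sup>2) \<and>
          v k \<noteq> 0 \<and>
          \<rho>s k \<in> {\<rho>lo..\<rho>hi} \<and>
          z (Suc k) = w k - (\<rho>s k * (((w k - zt k) \<bullet> v k) / (norm (v k))\<^sup>2)) *\<^sub>R v k)"

end

theory Submission
  imports Defs
begin

text \<open>The proof is of quasi-Fejer type. Fix a zero \<open>p\<close> of the operator and write
  \<open>d = w k - zt k\<close>, \<open>v = v k\<close>. The relative error test forces the angle between \<open>d\<close> and \<open>v\<close> to be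
  acute, quantitatively so, and monotonicity between \<open>(zt k, v)\<close> and \<open>(p, 0)\<close> then says that the
  half-space \<open>{x. v \<bullet> (x - zt k) \<le> 0}\<close> contains \<open>p\<close> but not \<open>w k\<close>. The next iterate is a relaxed
  projection of \<open>w k\<close> onto that half-space, so it is closer to \<open>p\<close> than \<open>w k\<close> by an amount comparable
  to \<open>(d \<bullet> v / norm v)\<^sup>2\<close>, and this controls both \<open>lam k *\<^sub>R v\<close> and \<open>d\<close>
  (\<open>relaxed_projection_decrease\<close> and \<open>relative_error_bounds\<close>).

  Expanding \<open>w k\<close> as an affine combination of \<open>z k\<close> and its predecessor, the squared distances
  \<open>\<phi> k\<close> from \<open>z k\<close> to \<open>p\<close> satisfy
  \<open>\<phi> (k + 1) - \<phi> k \<le> \<alpha>s k * (\<phi> k - \<phi> (k - 1)) + \<delta> k - c * (d \<bullet> v / norm v)\<^sup>2\<close> with \<open>\<delta>\<close> summable by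
  hypothesis and \<open>c > 0\<close>. Since the inertial weights stay below a constant less than 1, such a sequence
  converges (\<open>inertial_sequence_convergent\<close>). Hence the decrease terms tend to 0, and with them
  \<open>lam k *\<^sub>R v k\<close>, \<open>w k - zt k\<close>, and, because \<open>lam\<close> is bounded away from 0, also \<open>v k\<close>.

  Convergence of the distances makes \<open>z\<close> bounded, so it has a cluster point \<open>q\<close>. Along the same
  subsequence \<open>zt\<close> tends to \<open>q\<close> while \<open>v\<close> tends to 0, so \<open>q\<close> is a zero because the graph of a maximal
  monotone operator is closed (\<open>maximal_monotone_closed_graph\<close>). Choosing \<open>p = q\<close> above, the distance
  from \<open>z k\<close> to \<open>q\<close> converges and has a subsequence tending to 0; hence the whole sequence tends to \<open>q\<close>.\<close>

section \<open>Closed graph of a maximal monotone operator\<close>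

text \<open>The monotonicity inequality against any point of the graph survives the limit, so the limit
  point can be added to the graph without destroying monotonicity; by maximality it was already there.\<close>

lemma maximal_monotone_closed_graph:
  fixes T :: "real^'n \<Rightarrow> (real^'n) set"
  assumes max: "maximal_monotone_operator T"
    and graph: "\<And>k. u k \<in> T (x k)"
    and x: "x \<longlonglongrightarrow> q" and u: "u \<longlonglongrightarrow> y"
  shows "y \<in> T q"
proof -
  have mono: "(a - a') \<bullet> (b - b') \<ge> 0" if "b \<in> T a" "b' \<in> T a'" for a a' b b'
    using max that unfolding maximal_monotone_operator_def monotone_operator_def by blast
  have lim: "(q - a) \<bullet> (y - b) \<ge> 0" if "b \<in> T a" for a b
  proof (rule LIMSEQ_le_const)
    show "(\<lambda>k. (x k - a) \<bullet> (u k - b)) \<longlonglongrightarrow> (q - a) \<bullet> (y - b)"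
      by (intro tendsto_intros x u)
    show "\<exists>N. \<forall>k\<ge>N. 0 \<le> (x k - a) \<bullet> (u k - b)"
      using mono[OF graph that] by blast
  qed
  have lim': "(a - q) \<bullet> (b - y) \<ge> 0" if "b \<in> T a" for a b
    using lim[OF that] by (simp add: inner_diff_left inner_diff_right)
  define S where "S = T(q := insert y (T q))"
  have "monotone_operator S"
    unfolding monotone_operator_def S_def
    by (auto simp: mono lim lim' split: if_splits)
  moreover have "\<forall>a. T a \<subseteq> S a"
    by (auto simp: S_def)
  ultimately have "S = T"
    using max unfolding maximal_monotone_operator_def by blast
  then show ?thesis
    by (metis S_def fun_upd_same insertI1)
qed

section \<open>Sequences with an inertial recursion\<close>

text \<open>The positive parts \<open>t k\<close> of the increments contract up to a summable error:
  \<open>t (k + 1) \<le> \<alpha> * t k + \<delta> k\<close>. So they are summable, and subtracting their partial sums turns \<open>\<phi>\<close> into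
  a decreasing sequence that is bounded below. Truncated subtraction encodes that the term preceding
  \<open>\<phi> 0\<close> is \<open>\<phi> 0\<close> itself.\<close>

lemma inertial_sequence_convergent:
  fixes \<phi> a \<delta> :: "nat \<Rightarrow> real"
  assumes nonneg: "\<And>k. 0 \<le> \<phi> k"
    and a: "\<And>k. 0 \<le> a k" "\<And>k. a k \<le> \<alpha>" and "\<alpha> < 1"
    and \<delta>: "\<And>k. 0 \<le> \<delta> k" "summable \<delta>"
    and step: "\<And>k. \<phi> (Suc k) - \<phi> k \<le> a k * (\<phi> k - \<phi> (k - 1)) + \<delta> k"
  shows "convergent \<phi>"
proof -
  define t where "t k = max 0 (\<phi> k - \<phi> (k - 1))" for k
  have t_nonneg: "0 \<le> t k" for k by (simp add: t_def)
  have "0 \<le> \<alpha>" using a[of 0] by linarith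
  have t_step: "t (Suc k) \<le> \<alpha> * t k + \<delta> k" for k
  proof -
    have "a k * (\<phi> k - \<phi> (k - 1)) \<le> a k * t k"
      using a by (intro mult_left_mono) (auto simp: t_def)
    also have "\<dots> \<le> \<alpha> * t k"
      using a t_nonneg by (intro mult_right_mono) auto
    finally have "\<phi> (Suc k) - \<phi> k \<le> \<alpha> * t k + \<delta> k"
      using step[of k] by linarith
    moreover have "0 \<le> \<alpha> * t k + \<delta> k"
      using \<open>0 \<le> \<alpha>\<close> t_nonneg \<delta> by simp
    ultimately show ?thesis by (simp add: t_def)
  qed
  define D where "D = suminf \<delta>"
  have sum_le: "sum t {..<n} \<le> D / (1 - \<alpha>)" for n
  proof (induction n)
    case 0
    show ?case using \<delta> \<open>\<alpha> < 1\<close> by (simp add: D_def suminf_nonneg)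
  next
    case (Suc n)
    have "sum t {..<Suc n} = t 0 + (\<Sum>k<n. t (Suc k))"
      by (rule sum.lessThan_Suc_shift)
    also have "\<dots> \<le> (\<Sum>k<n. \<alpha> * t k + \<delta> k)"
      using sum_mono[of "{..<n}" "\<lambda>k. t (Suc k)" "\<lambda>k. \<alpha> * t k + \<delta> k"] t_step
      by (simp add: t_def)
    also have "\<dots> = \<alpha> * sum t {..<n} + sum \<delta> {..<n}"
      by (simp add: sum.distrib sum_distrib_left)
    also have "\<dots> \<le> \<alpha> * (D / (1 - \<alpha>)) + D"
      using Suc.IH \<open>0 \<le> \<alpha>\<close> \<delta> unfolding D_def
      by (intro add_mono mult_left_mono sum_le_suminf) auto
    also have "\<dots> = D / (1 - \<alpha>)"
      using \<open>\<alpha> < 1\<close> by (simp add: field_simps)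
    finally show ?case .
  qed
  have "summable t"
    by (rule bounded_imp_summable[where B = "D / (1 - \<alpha>)", OF t_nonneg])
       (unfold lessThan_Suc_atMost[symmetric], rule sum_le)
  define s where "s n = sum t {..<Suc n}" for n
  have "s \<longlonglongrightarrow> suminf t"
    unfolding s_def using \<open>summable t\<close> by (intro LIMSEQ_Suc summable_LIMSEQ)
  moreover have "decseq (\<lambda>n. \<phi> n - s n)"
    by (rule decseq_SucI) (simp add: s_def t_def)
  moreover have "- (D / (1 - \<alpha>)) \<le> \<phi> n - s n" for n
    using nonneg[of n] sum_le[of "Suc n"] unfolding s_def by linarith
  ultimately obtain L where "s \<longlonglongrightarrow> suminf t" "(\<lambda>n. \<phi> n - s n) \<longlonglongrightarrow> L"
    using decseq_convergent by blast
  then have "(\<lambda>n. (\<phi> n - s n) + s n) \<longlonglongrightarrow> L + suminf t"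
    by (intro tendsto_add)
  then show ?thesis by (auto simp: convergent_def)
qed

section \<open>Geometry of one iteration\<close>

lemma norm_sq_extrapolation:
  fixes x y p :: "'a::real_inner"
  shows "(norm (x + a *\<^sub>R (x - y) - p))\<^sup>2 =
    (norm (x - p))\<^sup>2 + a * ((norm (x - p))\<^sup>2 - (norm (y - p))\<^sup>2) + a * (1 + a) * (norm (x - y))\<^sup>2"
  by (simp add: power2_norm_eq_inner inner_simps inner_commute) (simp add: algebra_simps)

text \<open>The test bounds \<open>u \<bullet> d\<close> below by a multiple of \<open>(norm u)\<^sup>2 + (norm d)\<^sup>2\<close>; dividing by
  \<open>norm u\<close> bounds the first term directly, while for the second one uses
  \<open>2 * norm u * norm d \<le> (norm u)\<^sup>2 + (norm d)\<^sup>2\<close>.\<close>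

lemma relative_error_bounds:
  fixes u d :: "'a::real_inner"
  assumes test: "(norm (u - d))\<^sup>2 \<le> \<sigma>\<^sup>2 * ((norm d)\<^sup>2 + (norm u)\<^sup>2)"
    and \<sigma>: "0 \<le> \<sigma>" "\<sigma> < 1" and "u \<noteq> 0"
  shows "(1 - \<sigma>\<^sup>2) / 2 * norm u \<le> (d \<bullet> u) / norm u"
    and "(1 - \<sigma>\<^sup>2) / 2 * norm d \<le> (d \<bullet> u) / norm u"
proof -
  define c where "c = (1 - \<sigma>\<^sup>2) / 2"
  have "0 \<le> c" using \<sigma> by (simp add: c_def power_le_one)
  have "(norm (u - d))\<^sup>2 = (norm u)\<^sup>2 + (norm d)\<^sup>2 - 2 * (d \<bullet> u)"
    by (simp add: power2_norm_eq_inner inner_simps inner_commute)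
  then have key: "c * ((norm u)\<^sup>2 + (norm d)\<^sup>2) \<le> d \<bullet> u"
    using test by (simp add: c_def field_simps)
  have "(norm u)\<^sup>2 \<le> (norm u)\<^sup>2 + (norm d)\<^sup>2" by simp
  from mult_left_mono[OF this \<open>0 \<le> c\<close>] key
  show "(1 - \<sigma>\<^sup>2) / 2 * norm u \<le> (d \<bullet> u) / norm u"
    using \<open>u \<noteq> 0\<close> unfolding c_def[symmetric] by (simp add: field_simps power2_eq_square)
  have "2 * (norm d * norm u) \<le> (norm u)\<^sup>2 + (norm d)\<^sup>2"
    using sum_squares_bound[of "norm u" "norm d"] by (simp add: mult_ac)
  moreover have "0 \<le> norm d * norm u" by simp
  ultimately have "norm d * norm u \<le> (norm u)\<^sup>2 + (norm d)\<^sup>2" by linarith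
  from mult_left_mono[OF this \<open>0 \<le> c\<close>] key
  show "(1 - \<sigma>\<^sup>2) / 2 * norm d \<le> (d \<bullet> u) / norm u"
    using \<open>u \<noteq> 0\<close> unfolding c_def[symmetric] by (simp add: field_simps)
qed

text \<open>Here \<open>w - ((d \<bullet> v) / (norm v)\<^sup>2) *\<^sub>R v\<close> with \<open>d = w - y\<close> is the projection of \<open>w\<close> onto the half-space
  of all \<open>x\<close> with \<open>v \<bullet> (x - y) \<le> 0\<close>, to which \<open>p\<close> belongs. Moving by the factor \<open>\<rho>\<close> along this direction
  gains a first-order term \<open>2 * \<rho>\<close> and loses a second-order term \<open>\<rho>\<^sup>2\<close>.\<close>

lemma relaxed_projection_decrease:
  fixes w y v p :: "'a::real_inner"
  assumes "v \<noteq> 0" and sep: "0 \<le> (y - p) \<bullet> v" and pos: "0 \<le> (w - y) \<bullet> v" and "0 \<le> \<rho>"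
  shows "(norm (w - (\<rho> * (((w - y) \<bullet> v) / (norm v)\<^sup>2)) *\<^sub>R v - p))\<^sup>2
    \<le> (norm (w - p))\<^sup>2 - \<rho> * (2 - \<rho>) * (((w - y) \<bullet> v) / norm v)\<^sup>2"
proof -
  define s where "s = ((w - y) \<bullet> v) / (norm v)\<^sup>2"
  have s: "(w - y) \<bullet> v = s * (norm v)\<^sup>2" and "0 \<le> s"
    using \<open>v \<noteq> 0\<close> pos by (auto simp: s_def)
  have gap: "(((w - y) \<bullet> v) / norm v)\<^sup>2 = s\<^sup>2 * (norm v)\<^sup>2"
    using \<open>v \<noteq> 0\<close> by (simp add: s power2_eq_square)
  have "s * (norm v)\<^sup>2 \<le> (w - p) \<bullet> v"
    using sep s by (simp add: inner_diff_left)
  then have "2 * \<rho> * s * (s * (norm v)\<^sup>2) \<le> 2 * \<rho> * s * ((w - p) \<bullet> v)"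
    using \<open>0 \<le> \<rho>\<close> \<open>0 \<le> s\<close> by (intro mult_left_mono) auto
  moreover have "(norm (w - (\<rho> * s) *\<^sub>R v - p))\<^sup>2
      = (norm (w - p))\<^sup>2 - 2 * \<rho> * s * ((w - p) \<bullet> v) + \<rho>\<^sup>2 * s\<^sup>2 * (norm v)\<^sup>2"
    unfolding power2_norm_eq_inner
    by (simp add: inner_simps inner_commute) (simp add: algebra_simps power2_eq_square)
  ultimately show ?thesis
    unfolding gap s_def[symmetric] by (simp add: algebra_simps power2_eq_square)
qed

section \<open>Convergence of the method\<close>

theorem theorem2p4:
  fixes T :: "real^'n \<Rightarrow> (real^'n) set"
    and \<alpha> \<sigma> \<rho>lo \<rho>hi :: real
    and z w zt v :: "nat \<Rightarrow> real^'n"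
    and lam \<alpha>s \<rho>s :: "nat \<Rightarrow> real"
  assumes "maximal_monotone_operator T"
    and "inverse_operator T 0 \<noteq> {}"
    and "0 \<le> \<alpha>" and "\<alpha> < 1"
    and "0 \<le> \<sigma>" and "\<sigma> < 1"
    and "0 < \<rho>lo" and "\<rho>lo < \<rho>hi" and "\<rho>hi < 2"
    and "infinite_ihpp_run T \<alpha> \<sigma> \<rho>lo \<rho>hi z w zt v lam \<alpha>s \<rho>s"
    and "(INF k. lam k) > 0"
    and "summable (\<lambda>k. \<alpha>s k * (norm (z k - prev_iterate z k))\<^sup>2)"
  shows "\<exists>zinf. 0 \<in> T zinf \<and> z \<longlonglongrightarrow> zinf \<and> zt \<longlonglongrightarrow> zinf \<and> v \<longlonglongrightarrow> 0"
proof -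
  note max = assms(1) and \<sigma> = assms(5,6)
  have prev: "prev_iterate z k = z (k - 1)" for k
    by (cases k) (auto simp: prev_iterate_def)
  have run: "0 \<le> \<alpha>s k" "\<alpha>s k \<le> \<alpha>" "w k = z k + \<alpha>s k *\<^sub>R (z k - z (k - 1))" "0 < lam k"
      "v k \<in> T (zt k)" "v k \<noteq> 0" "\<rho>lo \<le> \<rho>s k" "\<rho>s k \<le> \<rho>hi"
      "(norm (lam k *\<^sub>R v k + zt k - w k))\<^sup>2
         \<le> \<sigma>\<^sup>2 * ((norm (zt k - w k))\<^sup>2 + (norm (lam k *\<^sub>R v k))\<^sup>2)"
      "z (Suc k) = w k - (\<rho>s k * (((w k - zt k) \<bullet> v k) / (norm (v k))\<^sup>2)) *\<^sub>R v k" for k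
    using assms(10) unfolding infinite_ihpp_run_def prev
    unfolding atLeastAtMost_iff by blast+
  have test: "(norm (lam k *\<^sub>R v k - (w k - zt k)))\<^sup>2
      \<le> \<sigma>\<^sup>2 * ((norm (w k - zt k))\<^sup>2 + (norm (lam k *\<^sub>R v k))\<^sup>2)" for k
    using run(9)[of k] unfolding diff_diff_eq2 norm_minus_commute[of "zt k" "w k"] .
  \<comment> \<open>The distance from \<open>w k\<close> to the separating half-space.\<close>
  define g where "g k = ((w k - zt k) \<bullet> v k) / norm (v k)" for k
  define c where "c = (1 - \<sigma>\<^sup>2) / 2"
  have "0 < c"
    using \<sigma> by (simp add: c_def abs_square_less_1)
  \<comment> \<open>A lower bound for \<open>\<rho>s k * (2 - \<rho>s k)\<close>, uniform in \<open>k\<close>.\<close>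
  define c' where "c' = \<rho>lo * (2 - \<rho>hi)"
  have "0 < c'" using assms(7,9) by (simp add: c'_def)

  have g_scaled: "((w k - zt k) \<bullet> (lam k *\<^sub>R v k)) / norm (lam k *\<^sub>R v k) = g k" for k
    using run(4)[of k] by (simp add: g_def)
  have u_le: "c * norm (lam k *\<^sub>R v k) \<le> g k" and d_le: "c * norm (w k - zt k) \<le> g k" for k
    using relative_error_bounds[OF test[of k] \<sigma>] run(4,6)[of k]
    unfolding g_scaled c_def by auto
  have g_nonneg: "0 \<le> g k" for k
    by (rule order_trans[OF _ d_le]) (use \<open>0 < c\<close> in simp)

  \<comment> \<open>The factor 2 absorbs \<open>1 + \<alpha>s k\<close> from the expansion of the extrapolated point.\<close>
  define \<delta> where "\<delta> k = 2 * (\<alpha>s k * (norm (z k - z (k - 1)))\<^sup>2)" for k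
  have \<delta>_nonneg: "0 \<le> \<delta> k" for k
    using run(1)[of k] by (simp add: \<delta>_def)
  have \<delta>: "summable \<delta>"
    using assms(12) unfolding \<delta>_def prev by (rule summable_mult)
  have \<delta>0: "\<delta> \<longlonglongrightarrow> 0" using \<delta> by (rule summable_LIMSEQ_zero)

  have step: "(norm (z (Suc k) - p))\<^sup>2 - (norm (z k - p))\<^sup>2
      \<le> \<alpha>s k * ((norm (z k - p))\<^sup>2 - (norm (z (k - 1) - p))\<^sup>2) + \<delta> k - c' * (g k)\<^sup>2"
    if "0 \<in> T p" for p k
  proof -
    have "monotone_operator T" using max by (simp add: maximal_monotone_operator_def)
    then have "0 \<le> (zt k - p) \<bullet> (v k - 0)"
      using run(5)[of k] that unfolding monotone_operator_def by blast
    moreover have "0 \<le> (w k - zt k) \<bullet> v k"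
      using g_nonneg[of k] run(6)[of k] by (simp add: g_def zero_le_divide_iff)
    ultimately have "(norm (z (Suc k) - p))\<^sup>2
        \<le> (norm (w k - p))\<^sup>2 - \<rho>s k * (2 - \<rho>s k) * (g k)\<^sup>2"
      using relaxed_projection_decrease[OF run(6)[of k], of "zt k" p "w k" "\<rho>s k"]
        run(7)[of k] assms(7) by (simp add: run(10) g_def)
    moreover have "c' * (g k)\<^sup>2 \<le> \<rho>s k * (2 - \<rho>s k) * (g k)\<^sup>2"
      unfolding c'_def using run(7,8)[of k] assms(7,9)
      by (intro mult_right_mono mult_mono) auto
    moreover have "\<alpha>s k * (1 + \<alpha>s k) * (norm (z k - z (k - 1)))\<^sup>2 \<le> \<delta> k"
    proof -
      have "(1 + \<alpha>s k) * (\<alpha>s k * (norm (z k - z (k - 1)))\<^sup>2) \<le> \<delta> k"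
        unfolding \<delta>_def using run(1,2)[of k] assms(4) by (intro mult_right_mono) auto
      then show ?thesis by (simp add: mult_ac)
    qed
    ultimately show ?thesis
      using norm_sq_extrapolation[of "z k" "\<alpha>s k" "z (k - 1)" p] by (simp add: run(3))
  qed

  have dist_convergent: "convergent (\<lambda>k. (norm (z k - p))\<^sup>2)" if "0 \<in> T p" for p
  proof (rule inertial_sequence_convergent[OF _ run(1,2) assms(4) \<delta>_nonneg \<delta>])
    fix k
    have "0 \<le> c' * (g k)\<^sup>2" using \<open>0 < c'\<close> by simp
    then show "(norm (z (Suc k) - p))\<^sup>2 - (norm (z k - p))\<^sup>2
        \<le> \<alpha>s k * ((norm (z k - p))\<^sup>2 - (norm (z (k - 1) - p))\<^sup>2) + \<delta> k"
      using step[OF that, of k] by linarith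
  qed simp

  obtain p where p: "0 \<in> T p" using assms(2) by (auto simp: inverse_operator_def)
  define \<phi> where "\<phi> k = (norm (z k - p))\<^sup>2" for k
  obtain L where L: "\<phi> \<longlonglongrightarrow> L"
    using dist_convergent[OF p] unfolding \<phi>_def convergent_def by blast
  \<comment> \<open>All terms of the step inequality except the decrease tend to 0, because \<open>\<phi>\<close> converges.\<close>
  have "(\<lambda>k. (g k)\<^sup>2) \<longlonglongrightarrow> 0"
  proof (rule tendsto_sandwich[OF _ _ tendsto_const])
    have "(\<lambda>k. \<phi> (k - 1)) \<longlonglongrightarrow> L"
      by (rule LIMSEQ_imp_Suc) (simp add: L)
    then have "(\<lambda>k. (\<bar>\<phi> k - \<phi> (k - 1)\<bar> + \<delta> k + (\<phi> k - \<phi> (Suc k))) / c')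
        \<longlonglongrightarrow> (\<bar>L - L\<bar> + 0 + (L - L)) / c'"
      using \<open>0 < c'\<close> by (intro tendsto_intros L \<delta>0 LIMSEQ_Suc) auto
    then show "(\<lambda>k. (\<bar>\<phi> k - \<phi> (k - 1)\<bar> + \<delta> k + (\<phi> k - \<phi> (Suc k))) / c') \<longlonglongrightarrow> 0"
      by simp
    have "(g k)\<^sup>2 \<le> (\<bar>\<phi> k - \<phi> (k - 1)\<bar> + \<delta> k + (\<phi> k - \<phi> (Suc k))) / c'" for k
    proof -
      have "\<alpha>s k * (\<phi> k - \<phi> (k - 1)) \<le> \<alpha>s k * \<bar>\<phi> k - \<phi> (k - 1)\<bar>"
        using run(1)[of k] by (intro mult_left_mono) auto
      also have "\<dots> \<le> \<bar>\<phi> k - \<phi> (k - 1)\<bar>"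
        using run(1,2)[of k] assms(4) by (intro mult_left_le_one_le) auto
      finally have "c' * (g k)\<^sup>2 \<le> \<bar>\<phi> k - \<phi> (k - 1)\<bar> + \<delta> k + (\<phi> k - \<phi> (Suc k))"
        using step[OF p, of k] unfolding \<phi>_def by linarith
      then show ?thesis using \<open>0 < c'\<close> by (simp add: field_simps)
    qed
    then show "\<forall>\<^sub>F k in sequentially.
        (g k)\<^sup>2 \<le> (\<bar>\<phi> k - \<phi> (k - 1)\<bar> + \<delta> k + (\<phi> k - \<phi> (Suc k))) / c'"
      by simp
  qed simp
  then have "(\<lambda>k. sqrt ((g k)\<^sup>2)) \<longlonglongrightarrow> sqrt 0" by (rule tendsto_real_sqrt)
  then have g0: "g \<longlonglongrightarrow> 0" using g_nonneg by simp

  define \<mu> where "\<mu> = (INF k. lam k)"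
  have "0 < \<mu>" using assms(11) by (simp add: \<mu>_def)
  have \<mu>_le: "\<mu> \<le> lam k" for k
  proof -
    have "bdd_below (range lam)" using less_imp_le[OF run(4)] by (intro bdd_belowI2)
    then show ?thesis unfolding \<mu>_def by (rule cINF_lower) simp
  qed
  have v0: "v \<longlonglongrightarrow> 0"
  proof (rule Lim_null_comparison[where g = "\<lambda>k. g k / (c * \<mu>)"])
    have "norm (v k) \<le> g k / (c * \<mu>)" for k
    proof -
      have "c * (\<mu> * norm (v k)) \<le> c * norm (lam k *\<^sub>R v k)"
        using \<mu>_le[of k] \<open>0 < c\<close> run(4)[of k] by (simp add: mult_right_mono)
      also have "\<dots> \<le> g k" by (rule u_le)
      finally show ?thesis using \<open>0 < c\<close> \<open>0 < \<mu>\<close> by (simp add: field_simps)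
    qed
    then show "\<forall>\<^sub>F k in sequentially. norm (v k) \<le> g k / (c * \<mu>)" by simp
    show "(\<lambda>k. g k / (c * \<mu>)) \<longlonglongrightarrow> 0"
      using tendsto_divide_zero[OF g0] .
  qed
  have wzt0: "(\<lambda>k. w k - zt k) \<longlonglongrightarrow> 0"
  proof (rule Lim_null_comparison[where g = "\<lambda>k. g k / c"])
    have "norm (w k - zt k) \<le> g k / c" for k
      using d_le[of k] \<open>0 < c\<close> by (simp add: field_simps)
    then show "\<forall>\<^sub>F k in sequentially. norm (w k - zt k) \<le> g k / c" by simp
    show "(\<lambda>k. g k / c) \<longlonglongrightarrow> 0"
      using tendsto_divide_zero[OF g0] .
  qed
  have wz0: "(\<lambda>k. w k - z k) \<longlonglongrightarrow> 0"
  proof (rule Lim_null_comparison[where g = "\<lambda>k. sqrt (\<delta> k)"])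
    have "norm (w k - z k) \<le> sqrt (\<delta> k)" for k
    proof (rule real_le_rsqrt)
      have "\<alpha>s k * \<alpha>s k \<le> 2 * \<alpha>s k"
        using run(1,2)[of k] assms(4) by (intro mult_right_mono) auto
      then have "\<alpha>s k * \<alpha>s k * (norm (z k - z (k - 1)))\<^sup>2 \<le> \<delta> k"
        unfolding \<delta>_def by (simp only: mult.assoc[symmetric] mult_right_mono zero_le_power2)
      then show "(norm (w k - z k))\<^sup>2 \<le> \<delta> k"
        by (simp add: run(3) power_mult_distrib power2_eq_square[of "\<alpha>s k"])
    qed
    then show "\<forall>\<^sub>F k in sequentially. norm (w k - z k) \<le> sqrt (\<delta> k)" by simp
    show "(\<lambda>k. sqrt (\<delta> k)) \<longlonglongrightarrow> 0"
      using tendsto_real_sqrt[OF \<delta>0] by simp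
  qed
  have ztz0: "(\<lambda>k. zt k - z k) \<longlonglongrightarrow> 0"
    using tendsto_diff[OF wz0 wzt0] by simp

  have "bounded (range z)"
  proof -
    from L have "Bseq \<phi>" using convergentI convergent_imp_Bseq by blast
    then obtain K where K: "\<And>k. norm (\<phi> k) \<le> K" by (auto simp: Bseq_def)
    have "dist p (z k) \<le> sqrt K" for k
      using K[of k] by (intro real_le_rsqrt) (simp add: \<phi>_def dist_norm norm_minus_commute)
    then show ?thesis unfolding bounded_def by blast
  qed
  then obtain q r where r: "strict_mono (r :: nat \<Rightarrow> nat)" and zr: "(z \<circ> r) \<longlonglongrightarrow> q"
    using bounded_imp_convergent_subsequence by blast
  have "(\<lambda>k. (zt (r k) - z (r k)) + z (r k)) \<longlonglongrightarrow> 0 + q"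
    using LIMSEQ_subseq_LIMSEQ[OF ztz0 r] zr by (intro tendsto_add) (auto simp: o_def)
  then have ztr: "(\<lambda>k. zt (r k)) \<longlonglongrightarrow> q" by simp
  have vr: "(\<lambda>k. v (r k)) \<longlonglongrightarrow> 0"
    using LIMSEQ_subseq_LIMSEQ[OF v0 r] by (simp add: o_def)
  have q: "0 \<in> T q"
    using maximal_monotone_closed_graph[OF max run(5) ztr vr] .

  obtain M where M: "(\<lambda>k. (norm (z k - q))\<^sup>2) \<longlonglongrightarrow> M"
    using dist_convergent[OF q] unfolding convergent_def by blast
  have "(\<lambda>k. (norm (z (r k) - q))\<^sup>2) \<longlonglongrightarrow> (norm (q - q))\<^sup>2"
    using zr by (intro tendsto_intros) (simp add: o_def)
  moreover have "(\<lambda>k. (norm (z (r k) - q))\<^sup>2) \<longlonglongrightarrow> M"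
    using LIMSEQ_subseq_LIMSEQ[OF M r] by (simp add: o_def)
  ultimately have "(norm (q - q))\<^sup>2 = M" by (rule LIMSEQ_unique)
  then have "M = 0" by simp
  then have "(\<lambda>k. norm (z k - q)) \<longlonglongrightarrow> 0"
    using tendsto_real_sqrt[OF M] by simp
  then have zq: "z \<longlonglongrightarrow> q"
    by (simp add: LIM_zero_iff tendsto_norm_zero_iff)
  have "zt \<longlonglongrightarrow> q"
    using tendsto_add[OF ztz0 zq] by simp
  with q zq v0 show ?thesis by blast
qed

end
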